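(* For every integer $k \geq 2$, $\mathsf{TT}^1_k\text{-}\mathsf{Ext} \equiv_{\mathrm{W}} \mathsf{WF}$.
   Context: A problem $\mathsf{P}$ is a partial multivalued function from $\omega^\omega$ to $\omega^\omega$; elements of its domain are its instances, and for each instance $x$ the set $\mathsf{P}(x)$ of its solutions is nonempty. All objects (numbers, finite strings, subsets of $\omega$ or of $\omega^{<\omega}$, colorings) are coded as elements of $\omega^\omega$ via standard codings. $\mathsf{P} \leq_{\mathrm{W}} \mathsf{Q}$ (Weihrauch reducibility) means there are Turing functionals $\Phi,\Psi$ such that for every instance $x$ of $\mathsf{P}$, $\Phi(x)$ is an instance of $\mathsf{Q}$, and for every $\mathsf{Q}$-solution $y$ of $\Phi(x)$, $\Psi(x \oplus y)$ is a $\mathsf{P}$-solution of $x$; $\mathsf{P}\equiv_{\mathrm{W}}\mathsf{Q}$ means both $\mathsf{P}\leq_{\mathrm{W}}\mathsf{Q}$ and $\mathsf{Q}\leq_{\mathrm{W}}\mathsf{P}$. For $S \subseteq 2^{<\omega}$ and $n\in\omega\cup\{\omega\}$, $S \cong 2^{<n}$ means $(S,\preceq)$ is isomorphic as a partial order to $(2^{<n},\preceq)$, where $\preceq$ is the prefix relation and $2^{<n}$ is the set of binary strings of length $<n$. A set $H$ is monochromatic for a coloring $f$ if $f$ is constant on $H$. $\mathsf{WF}$ is the problem whose instances are all trees $T \subseteq \omega^{<\omega}$ (sets closed under prefixes), the unique solution being $0$ if $T$ has an infinite path and $1$ if $T$ is well-founded. $\mathsf{TT}^1_k\text{-}\mathsf{Ext}$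 is the problem whose instances are pairs $\langle f,\sigma\rangle$ with $f:2^{<\omega}\to k=\{0,\dots,k-1\}$ and $\sigma\in 2^{<\omega}$, the unique solution being $1$ if there exists $H \cong 2^{<\omega}$ monochromatic for $f$ with $\sigma \in H$, and $0$ otherwise. *)

theory Defs
  imports Complex_Main "HOL-Library.Nat_Bijection" "HOL-Library.Sublist"
begin

section \<open>Turing functionals\<close>

text \<open>
  Turing functionals are given by the partial recursive functions relative to an oracle
  \<open>x\<close>: the basic functions together with the oracle query \<open>a \<mapsto> x a\<close>, closed under
  composition, primitive recursion and minimisation.
\<close>

type_synonym baire = "nat \<Rightarrow> nat"

datatype program =
    Zero
  | Succ
  | Query
  | Proj nat
  | Comp program "program list"
  | PrimRec program program
  | Mu program

inductive eval :: "baire \<Rightarrow> program \<Rightarrow> nat list \<Rightarrow> nat \<Rightarrow> bool" for x :: baire where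
  Zero: "eval x Zero as 0"
| Succ: "eval x Succ [a] (Suc a)"
| Query: "eval x Query [a] (x a)"
| Proj: "i < length as \<Longrightarrow> eval x (Proj i) as (as ! i)"
| Comp: "list_all2 (\<lambda>q b. eval x q as b) qs bs \<Longrightarrow> eval x p bs c \<Longrightarrow> eval x (Comp p qs) as c"
| PrimRec_0: "eval x p as c \<Longrightarrow> eval x (PrimRec p q) (0 # as) c"
| PrimRec_Suc: "eval x (PrimRec p q) (n # as) b \<Longrightarrow> eval x q (n # b # as) c
    \<Longrightarrow> eval x (PrimRec p q) (Suc n # as) c"
| Mu: "(\<And>m. m < n \<Longrightarrow> \<exists>v. eval x p (m # as) (Suc v)) \<Longrightarrow> eval x p (n # as) 0
    \<Longrightarrow> eval x (Mu p) as n"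

inductive_cases eval_ZeroE: "eval x Zero as c"
  and eval_SuccE: "eval x Succ as c"
  and eval_QueryE: "eval x Query as c"
  and eval_ProjE: "eval x (Proj i) as c"
  and eval_CompE: "eval x (Comp p qs) as c"
  and eval_PrimRec_0E: "eval x (PrimRec p q) (0 # as) c"
  and eval_PrimRec_SucE: "eval x (PrimRec p q) (Suc n # as) c"
  and eval_MuE: "eval x (Mu p) as c"

lemma eval_deterministic: "eval x p as b \<Longrightarrow> eval x p as c \<Longrightarrow> b = c"
proof (induction arbitrary: c rule: eval.induct)
  case (Comp as qs bs p d)
  from Comp.prems obtain bs' where bs': "list_all2 (\<lambda>q b. eval x q as b) qs bs'" "eval x p bs' c"
    by (rule eval_CompE)
  have "bs = bs'"
    using Comp.IH(1) bs'(1) by (simp add: list_all2_conv_all_nth list_eq_iff_nth_eq)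
  with bs'(2) Comp.IH(2) show ?case by blast
next
  case (PrimRec_Suc p q n as b d)
  from PrimRec_Suc.prems obtain b' where "eval x (PrimRec p q) (n # as) b'" "eval x q (n # b' # as) c"
    by (rule eval_PrimRec_SucE)
  with PrimRec_Suc.IH show ?case by blast
next
  case (Mu n p as)
  from Mu.prems have c: "eval x p (c # as) 0" "\<And>m. m < c \<Longrightarrow> \<exists>v. eval x p (m # as) (Suc v)"
    by (blast elim: eval_MuE)+
  have "\<not> c < n"
  proof
    assume "c < n"
    with Mu.IH(1) obtain v where "\<forall>d. eval x p (c # as) d \<longrightarrow> Suc v = d" by blast
    with c(1) show False by blast
  qed
  moreover have "\<not> n < c"
  proof
    assume "n < c"
    with c(2) obtain v where "eval x p (n # as) (Suc v)" by blast
    with Mu.IH(2) show False by blast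
  qed
  ultimately show ?case by simp
qed (blast elim: eval_ZeroE eval_SuccE eval_QueryE eval_ProjE eval_PrimRec_0E)+

text \<open>
  The functional with program \<open>p\<close> is defined at \<open>x\<close> if the computation with oracle \<open>x\<close>
  halts on every \<open>n\<close>; by determinism the value \<open>y\<close> is then unique.
\<close>

definition computes :: "program \<Rightarrow> baire \<Rightarrow> baire \<Rightarrow> bool" where
  "computes p x y \<longleftrightarrow> (\<forall>n. eval x p [n] (y n))"

definition turing_functional :: "(baire \<Rightarrow> baire option) \<Rightarrow> bool" where
  "turing_functional \<Phi> \<longleftrightarrow> (\<exists>p. \<forall>x y. \<Phi> x = Some y \<longleftrightarrow> computes p x y)"

section \<open>Problems and Weihrauch reducibility\<close>

text \<open>A partial multivalued function; \<open>x\<close> lies outside the domain iff its set of values is empty.\<close>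

type_synonym problem = "baire \<Rightarrow> baire set"

definition is_instance :: "problem \<Rightarrow> baire \<Rightarrow> bool" where
  "is_instance P x \<longleftrightarrow> P x \<noteq> {}"

definition join :: "baire \<Rightarrow> baire \<Rightarrow> baire"  (infixl \<open>\<oplus>\<close> 65) where
  "x \<oplus> y = (\<lambda>n. if even n then x (n div 2) else y (n div 2))"

definition weihrauch_le :: "problem \<Rightarrow> problem \<Rightarrow> bool"  (infix \<open>\<le>\<^sub>W\<close> 50) where
  "P \<le>\<^sub>W Q \<longleftrightarrow> (\<exists>\<Phi> \<Psi>. turing_functional \<Phi> \<and> turing_functional \<Psi> \<and>
     (\<forall>x. is_instance P x \<longrightarrow>
        (\<exists>z. \<Phi> x = Some z \<and> is_instance Q z \<and>
           (\<forall>y \<in> Q z. \<exists>w. \<Psi> (x \<oplus> y) = Some w \<and> w \<in> P x))))"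

definition weihrauch_equiv :: "problem \<Rightarrow> problem \<Rightarrow> bool"  (infix \<open>\<equiv>\<^sub>W\<close> 50) where
  "P \<equiv>\<^sub>W Q \<longleftrightarrow> P \<le>\<^sub>W Q \<and> Q \<le>\<^sub>W P"

section \<open>Codings\<close>

text \<open>
  A number \<open>n\<close> is coded as the sequence \<open>n, 0, 0, \<dots>\<close>.  Elements of \<open>2\<^sup><\<^sup>\<omega>\<close> are bool lists,
  numbered bijectively (bijective base-2 notation); elements of \<open>\<omega>\<^sup><\<^sup>\<omega>\<close> are numbered by
  the bijection \<^const>\<open>list_encode\<close>.
\<close>

definition code_nat :: "nat \<Rightarrow> baire" where
  "code_nat n = (\<lambda>i. if i = 0 then n else 0)"

fun bin_encode :: "bool list \<Rightarrow> nat" where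
  "bin_encode [] = 0"
| "bin_encode (b # \<sigma>) = 2 * bin_encode \<sigma> + (if b then 2 else 1)"

lemma bij_bin_encode: "bij bin_encode"
proof (rule bijI)
  have "bin_encode \<sigma> = bin_encode \<tau> \<Longrightarrow> \<sigma> = \<tau>" for \<sigma> \<tau>
  proof (induction \<sigma> arbitrary: \<tau>)
    case Nil
    then show ?case by (cases \<tau>) (auto split: if_splits)
  next
    case (Cons a \<sigma>)
    then obtain b \<rho> where \<tau>: "\<tau> = b # \<rho>" by (cases \<tau>) (auto split: if_splits)
    with Cons.prems have "a = b \<and> bin_encode \<sigma> = bin_encode \<rho>"
      by (cases a; cases b) (simp_all; presburger)+
    with Cons.IH \<tau> show ?case by blast
  qed
  then show "inj bin_encode" by (auto intro: injI)
  have "\<exists>\<sigma>. n = bin_encode \<sigma>" for n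
  proof (induction n rule: less_induct)
    case (less n)
    show ?case
    proof (cases "n = 0")
      case True
      then show ?thesis by (metis bin_encode.simps(1))
    next
      case False
      then have "(n - 1) div 2 < n" by simp
      with less obtain \<sigma> where "(n - 1) div 2 = bin_encode \<sigma>" by blast
      then have "n = bin_encode (even n # \<sigma>)" using False by (simp; presburger)
      then show ?thesis by blast
    qed
  qed
  then show "surj bin_encode" by (auto simp: surj_def)
qed

definition code_coloring :: "(bool list \<Rightarrow> nat) \<Rightarrow> baire" where
  "code_coloring f = (\<lambda>n. f (inv bin_encode n))"

definition code_tree :: "nat list set \<Rightarrow> baire" where
  "code_tree T = (\<lambda>n. if list_decode n \<in> T then 1 else 0)"

section \<open>The two problems\<close>

definition is_tree :: "nat list set \<Rightarrow> bool" where
  "is_tree T \<longleftrightarrow> (\<forall>\<tau> \<in> T. \<forall>\<sigma>. prefix \<sigma> \<tau> \<longrightarrow> \<sigma> \<in> T)"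

definition has_infinite_path :: "nat list set \<Rightarrow> bool" where
  "has_infinite_path T \<longleftrightarrow> (\<exists>g :: nat \<Rightarrow> nat. \<forall>n. map g [0..<n] \<in> T)"

definition WF_problem :: problem where
  "WF_problem x = {y. \<exists>T. is_tree T \<and> x = code_tree T \<and>
     y = code_nat (if has_infinite_path T then 0 else 1)}"

definition prefix_isomorphic :: "bool list set \<Rightarrow> bool list set \<Rightarrow> bool"  (infix \<open>\<cong>\<^sub>p\<close> 50) where
  "S \<cong>\<^sub>p S' \<longleftrightarrow> (\<exists>h. bij_betw h S S' \<and>
     (\<forall>\<sigma> \<in> S. \<forall>\<tau> \<in> S. prefix \<sigma> \<tau> \<longleftrightarrow> prefix (h \<sigma>) (h \<tau>)))"

definition monochromatic :: "(bool list \<Rightarrow> nat) \<Rightarrow> bool list set \<Rightarrow> bool" where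
  "monochromatic f H \<longleftrightarrow> (\<exists>c. \<forall>\<tau> \<in> H. f \<tau> = c)"

definition TT1_Ext :: "nat \<Rightarrow> problem" where
  "TT1_Ext k x = {y. \<exists>f \<sigma>. range f \<subseteq> {..<k} \<and>
     x = code_coloring f \<oplus> code_nat (bin_encode \<sigma>) \<and>
     y = code_nat (if \<exists>H. H \<cong>\<^sub>p UNIV \<and> monochromatic f H \<and> \<sigma> \<in> H then 1 else 0)}"

end

theory Submission
  imports Defs
begin

text \<open>
  A monochromatic \<open>H \<cong> 2\<^sup><\<^sup>\<omega>\<close> containing \<open>\<sigma>\<close> may be replaced by its cone above \<open>\<sigma>\<close>.  Enumerating this cone
  level by level, the existence of \<open>H\<close> says that there is a sequence of strings starting with \<open>\<sigma>\<close>, all of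
  the same colour, in which each string properly extends its parent and is incomparable with its sibling.
  These conditions are decidable from finitely many terms of the sequence, so the sequences are the paths
  of a computable tree.

  Conversely, colour a binary string \<open>0\<^sup>a 1 0\<^sup>b 1 \<dots> 1 0\<^sup>m\<close> by whether \<open>(\<lfloor>a/2\<rfloor>, \<lfloor>b/2\<rfloor>, \<dots>) \<in> T\<close>.  A path of
  \<open>T\<close> has two preimages of each of its terms, which gives a full binary tree of colour 1.  In a full binary
  tree of colour 1 one can always move to a node with a further 1, and hence reach a path of \<open>T\<close>.

  In both directions the answers are complementary, so the second functional is \<open>y \<mapsto> 1 - y\<close>.
\<close>

section \<open>Computable functions\<close>

text \<open>One program serves all oracles, and only total functions occur, since both reductions
  can be made total. Writing arguments as \<open>as ! i\<close> lets the rules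
  \<open>computable_intros\<close> follow the syntax of a term.\<close>

definition computable :: "nat \<Rightarrow> (baire \<Rightarrow> nat list \<Rightarrow> nat) \<Rightarrow> bool" where
  "computable k F \<longleftrightarrow> (\<exists>p. \<forall>x as. length as = k \<longrightarrow> eval x p as (F x as))"

named_theorems computable_intros

lemma computable_cong:
  assumes "computable k F" "\<And>x as. length as = k \<Longrightarrow> F x as = G x as"
  shows "computable k G"
  using assms unfolding computable_def by metis

lemma turing_functional_computable:
  assumes "computable 1 F"
  shows "turing_functional (\<lambda>x. Some (\<lambda>n. F x [n]))"
proof -
  obtain p where p: "\<And>x as. length as = 1 \<Longrightarrow> eval x p as (F x as)"
    using assms unfolding computable_def by blast
  have "(\<lambda>n. F x [n]) = y \<longleftrightarrow> computes p x y" for x y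
    unfolding computes_def using p[of "[_]" x] eval_deterministic by (fastforce simp: fun_eq_iff)
  then show ?thesis unfolding turing_functional_def by auto
qed

lemma computable_comp:
  assumes F: "computable m F" and m: "length Gs = m" and Gs: "\<And>G. G \<in> set Gs \<Longrightarrow> computable k G"
  shows "computable k (\<lambda>x as. F x (map (\<lambda>G. G x as) Gs))"
proof -
  obtain p where p: "\<And>x as. length as = m \<Longrightarrow> eval x p as (F x as)"
    using F unfolding computable_def by blast
  have "\<forall>G\<in>set Gs. \<exists>q. \<forall>x as. length as = k \<longrightarrow> eval x q as (G x as)"
    using Gs unfolding computable_def by blast
  then obtain q where q: "\<forall>G\<in>set Gs. \<forall>x as. length as = k \<longrightarrow> eval x (q G) as (G x as)"
    by (auto dest: bchoice)
  have "eval x (Comp p (map q Gs)) as (F x (map (\<lambda>G. G x as) Gs))" if "length as = k" for x as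
  proof (rule eval.Comp)
    show "list_all2 (\<lambda>q b. eval x q as b) (map q Gs) (map (\<lambda>G. G x as) Gs)"
      using q that by (auto simp: list_all2_conv_all_nth)
    show "eval x p (map (\<lambda>G. G x as) Gs) (F x (map (\<lambda>G. G x as) Gs))"
      using p m by simp
  qed
  then show ?thesis unfolding computable_def by blast
qed

lemma computable_nth [computable_intros]: "i < k \<Longrightarrow> computable k (\<lambda>x as. as ! i)"
  unfolding computable_def by (metis eval.Proj)

lemma computable_tl_nth [computable_intros]: "Suc i < k \<Longrightarrow> computable k (\<lambda>x as. tl as ! i)"
  by (rule computable_cong[OF computable_nth[of "Suc i"]]) (auto simp: nth_tl)

lemma computable_tl_tl_nth [computable_intros]:
  "Suc (Suc i) < k \<Longrightarrow> computable k (\<lambda>x as. tl (tl as) ! i)"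
  by (rule computable_cong[OF computable_nth[of "Suc (Suc i)"]]) (auto simp: nth_tl)

lemma computable_subst1:
  assumes "computable (Suc 0) (\<lambda>x as. F x (as ! 0))" "computable k A"
  shows "computable k (\<lambda>x as. F x (A x as))"
  using computable_comp[OF assms(1), of "[A]"] assms(2) by simp

lemma computable_subst2:
  assumes "computable (Suc (Suc 0)) (\<lambda>x as. F x (as ! 0) (as ! 1))" "computable k A" "computable k B"
  shows "computable k (\<lambda>x as. F x (A x as) (B x as))"
  using computable_comp[OF assms(1), of "[A, B]" k] assms(2,3) by auto

lemma computable_Suc [computable_intros]: "computable k A \<Longrightarrow> computable k (\<lambda>x as. Suc (A x as))"
proof (rule computable_subst1[where F = "\<lambda>_. Suc"])
  show "computable (Suc 0) (\<lambda>x as. Suc (as ! 0))"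
    unfolding computable_def by (rule exI[of _ Succ]) (auto simp: length_Suc_conv intro: eval.Succ)
qed

lemma computable_query [computable_intros]: "computable k A \<Longrightarrow> computable k (\<lambda>x as. x (A x as))"
proof (rule computable_subst1[where F = "\<lambda>x. x"])
  show "computable (Suc 0) (\<lambda>x as. x (as ! 0))"
    unfolding computable_def by (rule exI[of _ Query]) (auto simp: length_Suc_conv intro: eval.Query)
qed

lemma computable_const [computable_intros]: "computable k (\<lambda>x as. c)"
proof (induction c)
  case 0
  show ?case unfolding computable_def using eval.Zero by blast
next
  case (Suc c)
  then show ?case by (rule computable_Suc)
qed

text \<open>
  Variables bound by recursion and by bounded quantifiers become the first arguments, so under a
  binder the outer arguments are \<open>tl as\<close> or \<open>tl (tl as)\<close>.
\<close>

lemma computable_rec_nat [computable_intros]: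
  assumes A: "computable k A" and N: "computable k N"
    and B: "computable (Suc (Suc k)) (\<lambda>x as. B x (as ! 0) (as ! 1) (tl (tl as)))"
  shows "computable k (\<lambda>x as. rec_nat (A x as) (\<lambda>n b. B x n b as) (N x as))"
proof -
  obtain p where p: "\<And>x as. length as = k \<Longrightarrow> eval x p as (A x as)"
    using A unfolding computable_def by blast
  obtain q where q: "\<And>x as. length as = Suc (Suc k) \<Longrightarrow> eval x q as (B x (as ! 0) (as ! 1) (tl (tl as)))"
    using B unfolding computable_def by blast
  have rec: "eval x (PrimRec p q) (n # as) (rec_nat (A x as) (\<lambda>n b. B x n b as) n)"
    if "length as = k" for x n as
  proof (induction n)
    case 0
    show ?case using p[OF that] by (simp add: eval.PrimRec_0)
  next
    case (Suc n)
    show ?case using eval.PrimRec_Suc[OF Suc q] that by simp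
  qed
  have "computable (Suc k) (\<lambda>x as. rec_nat (A x (tl as)) (\<lambda>n b. B x n b (tl as)) (hd as))"
    unfolding computable_def by (rule exI[of _ "PrimRec p q"]) (auto simp: length_Suc_conv intro: rec)
  \<comment> \<open>\<open>PrimRec\<close> recurses on its first argument; composing with
    \<open>N\<close> and all projections makes the number of rounds a computable function of the
    parameters.\<close>
  then have *: "computable k (\<lambda>x as. (\<lambda>x as. rec_nat (A x (tl as)) (\<lambda>n b. B x n b (tl as)) (hd as)) x
      (map (\<lambda>G. G x as) (N # map (\<lambda>i x as. as ! i) [0..<k])))"
    by (rule computable_comp) (auto intro: N computable_nth)
  have args: "map (\<lambda>G. G x as) (N # map (\<lambda>i x as. as ! i) [0..<k]) = N x as # as"
    if "length as = k" for x :: baire and as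
    using that map_nth[of as] by (simp add: comp_def)
  show ?thesis by (rule computable_cong[OF *]) (simp only: args list.sel)
qed

text \<open>Serves the bounded quantifiers: the step of their recursion also receives the value
  accumulated so far, which the predicate ignores. The projections skip that argument, which has
  index 1.\<close>

lemma computable_weaken:
  assumes "computable (Suc k) (\<lambda>x as. P x (as ! 0) (tl as))"
  shows "computable (Suc (Suc k)) (\<lambda>x as. P x (as ! 0) (tl (tl as)))"
proof -
  let ?Gs = "map (\<lambda>i x as. as ! i) (0 # [2..<Suc (Suc k)]) :: (baire \<Rightarrow> nat list \<Rightarrow> nat) list"
  have *: "computable (Suc (Suc k)) (\<lambda>x as. (\<lambda>x as. P x (as ! 0) (tl as)) x (map (\<lambda>G. G x as) ?Gs))"
    by (rule computable_comp[OF assms]) (auto intro: computable_nth)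
  have args: "map (\<lambda>G. G x as) ?Gs = as ! 0 # tl (tl as)" if "length as = Suc (Suc k)" for x :: baire and as
    using that by (auto simp: list_eq_iff_nth_eq nth_Cons nth_tl simp del: upt_Suc split: nat.splits)
  show ?thesis by (rule computable_cong[OF *]) (simp only: args nth_Cons_0 list.sel)
qed

section \<open>Arithmetic, decidable predicates and recursion along a decreasing function\<close>

lemma computable_add [computable_intros]:
  assumes "computable k A" "computable k B"
  shows "computable k (\<lambda>x as. A x as + B x as)"
proof -
  have *: "computable k (\<lambda>x as. rec_nat (A x as) (\<lambda>_ b. Suc b) (B x as))"
    by (intro computable_intros assms) simp_all
  have eq: "rec_nat a (\<lambda>_ b. Suc b) b = a + b" for a b by (induction b) auto
  show ?thesis by (rule computable_cong[OF *]) (simp only: eq)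
qed

lemma computable_mult [computable_intros]:
  assumes "computable k A" "computable k B"
  shows "computable k (\<lambda>x as. A x as * B x as)"
proof (rule computable_subst2[OF _ assms])
  have *: "computable (Suc (Suc 0)) (\<lambda>x as. rec_nat 0 (\<lambda>_ b. b + as ! 0) (as ! 1))"
    by (intro computable_intros) simp_all
  have eq: "rec_nat 0 (\<lambda>_ b. b + a) b = a * b" for a b :: nat by (induction b) auto
  show "computable (Suc (Suc 0)) (\<lambda>x as. as ! 0 * as ! 1)"
    by (rule computable_cong[OF *]) (simp only: eq)
qed

lemma computable_pred:
  assumes "computable k A"
  shows "computable k (\<lambda>x as. A x as - 1)"
proof -
  have *: "computable k (\<lambda>x as. rec_nat 0 (\<lambda>n _. n) (A x as))"
    by (intro computable_intros assms) simp_all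
  have eq: "rec_nat 0 (\<lambda>n _. n) a = a - 1" for a by (cases a) auto
  show ?thesis by (rule computable_cong[OF *]) (simp only: eq)
qed

lemma computable_diff [computable_intros]:
  assumes "computable k A" "computable k B"
  shows "computable k (\<lambda>x as. A x as - B x as)"
proof -
  have *: "computable k (\<lambda>x as. rec_nat (A x as) (\<lambda>_ b. b - 1) (B x as))"
    by (intro computable_intros computable_pred assms) simp_all
  have eq: "rec_nat a (\<lambda>_ b. b - 1) b = a - b" for a b :: nat by (induction b) auto
  show ?thesis by (rule computable_cong[OF *]) (simp only: eq)
qed

lemma computable_if [computable_intros]:
  assumes "computable k (\<lambda>x as. of_bool (P x as))" "computable k A" "computable k B"
  shows "computable k (\<lambda>x as. if P x as then A x as else B x as)"
proof -
  have *: "computable k (\<lambda>x as. of_bool (P x as) * A x as + (1 - of_bool (P x as)) * B x as)"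
    by (intro computable_intros assms)
  show ?thesis by (rule computable_cong[OF *]) simp
qed

lemma computable_not [computable_intros]:
  assumes "computable k (\<lambda>x as. of_bool (P x as))"
  shows "computable k (\<lambda>x as. of_bool (\<not> P x as))"
proof -
  have *: "computable k (\<lambda>x as. 1 - of_bool (P x as))" by (intro computable_intros assms)
  show ?thesis by (rule computable_cong[OF *]) simp
qed

lemma computable_conj [computable_intros]:
  assumes "computable k (\<lambda>x as. of_bool (P x as))" "computable k (\<lambda>x as. of_bool (Q x as))"
  shows "computable k (\<lambda>x as. of_bool (P x as \<and> Q x as))"
proof -
  have *: "computable k (\<lambda>x as. of_bool (P x as) * of_bool (Q x as))" by (intro computable_intros assms)
  show ?thesis by (rule computable_cong[OF *]) simp
qed

lemma computable_imp [computable_intros]: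
  assumes "computable k (\<lambda>x as. of_bool (P x as))" "computable k (\<lambda>x as. of_bool (Q x as))"
  shows "computable k (\<lambda>x as. of_bool (P x as \<longrightarrow> Q x as))"
proof -
  have *: "computable k (\<lambda>x as. of_bool (\<not> (P x as \<and> \<not> Q x as)))" by (intro computable_intros assms)
  show ?thesis by (rule computable_cong[OF *]) simp
qed

lemma computable_eq [computable_intros]:
  assumes "computable k A" "computable k B"
  shows "computable k (\<lambda>x as. of_bool (A x as = B x as))"
proof -
  have *: "computable k (\<lambda>x as. 1 - ((A x as - B x as) + (B x as - A x as)))"
    by (intro computable_intros assms)
  show ?thesis by (rule computable_cong[OF *]) auto
qed

lemma computable_all [computable_intros]:
  assumes P: "computable (Suc k) (\<lambda>x as. of_bool (P x (as ! 0) (tl as)))" and N: "computable k N"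
  shows "computable k (\<lambda>x as. of_bool (\<forall>i<N x as. P x i as))"
proof -
  have *: "computable k (\<lambda>x as. rec_nat 1 (\<lambda>i b. of_bool (P x i as) * b) (N x as))"
    by (intro computable_intros computable_weaken P N) simp_all
  have eq: "rec_nat 1 (\<lambda>i b. of_bool (Q i) * b) n = (of_bool (\<forall>i<n. Q i) :: nat)" for Q n
    by (induction n) (auto simp: less_Suc_eq)
  show ?thesis by (rule computable_cong[OF *]) (simp only: eq)
qed

lemma computable_ex [computable_intros]:
  assumes P: "computable (Suc k) (\<lambda>x as. of_bool (P x (as ! 0) (tl as)))" and N: "computable k N"
  shows "computable k (\<lambda>x as. of_bool (\<exists>i<N x as. P x i as))"
proof -
  have *: "computable k (\<lambda>x as. of_bool (\<not> (\<forall>i<N x as. \<not> P x i as)))"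
    by (intro computable_intros assms)
  show ?thesis by (rule computable_cong[OF *]) simp
qed

lemma computable_funpow [computable_intros]:
  assumes t: "computable (Suc 0) (\<lambda>x as. t (as ! 0))" and "computable k A" "computable k N"
  shows "computable k (\<lambda>x as. (t ^^ N x as) (A x as))"
proof -
  have *: "computable k (\<lambda>x as. rec_nat (A x as) (\<lambda>_ b. t b) (N x as))"
    by (intro computable_intros assms computable_subst1[where F = "\<lambda>_. t", OF t]) simp_all
  have eq: "rec_nat a (\<lambda>_ b. t b) n = (t ^^ n) a" for a n by (induction n) auto
  show ?thesis by (rule computable_cong[OF *]) (simp only: eq)
qed

text \<open>Makes recursion on codes available, where the code of a tail is smaller than the code of
  the whole. The chain \<open>n\<close>, \<open>t n\<close>, \<open>t (t n)\<close>, ... reaches 0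
  within \<open>n\<close> steps, and \<open>F\<close> is computed along it backwards by primitive
  recursion.\<close>

lemma computable_wf_rec:
  fixes F t :: "nat \<Rightarrow> nat"
  assumes F: "\<And>n. n > 0 \<Longrightarrow> F n = G n (F (t n))"
    and t0: "t 0 = 0" and t_less: "\<And>n. n > 0 \<Longrightarrow> t n < n"
    and t: "computable (Suc 0) (\<lambda>x as. t (as ! 0))"
    and G: "computable (Suc (Suc 0)) (\<lambda>x as. G (as ! 0) (as ! 1))"
    and A: "computable k A"
  shows "computable k (\<lambda>x as. F (A x as))"
proof (rule computable_subst1[OF _ A])
  \<comment> \<open>After \<open>j\<close> rounds the value is \<open>F\<close> at the point
    \<open>n - j\<close> steps down the chain. If the chain reaches 0 early, the value
    \<open>F 0\<close> is carried along until the first positive element.\<close>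
  define R where "R n = rec_nat (F 0)
    (\<lambda>j r. if (t ^^ (n - Suc j)) n = 0 then r else G ((t ^^ (n - Suc j)) n) r)" for n
  have le: "(t ^^ j) n \<le> n - j" for n j
  proof (induction j)
    case (Suc j)
    then show ?case using t_less[of "(t ^^ j) n"] t0 by (cases "(t ^^ j) n = 0") auto
  qed simp
  have "R n j = F ((t ^^ (n - j)) n)" if "j \<le> n" for n j
    using that
  proof (induction j)
    case 0
    show ?case using le[of n n] by (simp add: R_def)
  next
    case (Suc j)
    define m where "m = (t ^^ (n - Suc j)) n"
    have "n - j = Suc (n - Suc j)" using Suc.prems by simp
    then have "(t ^^ (n - j)) n = t m" by (simp add: m_def)
    moreover have "R n (Suc j) = (if m = 0 then R n j else G m (R n j))"
      by (simp add: R_def m_def)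
    ultimately show ?case using Suc F[of m] t0 by (auto simp: m_def)
  qed
  from this[of n n for n] have eq: "R n n = F n" for n by simp
  have *: "computable (Suc 0) (\<lambda>x as. R (as ! 0) (as ! 0))"
    unfolding R_def
    by (intro computable_intros t computable_subst2[where F = "\<lambda>_. G", OF G]) simp_all
  show "computable (Suc 0) (\<lambda>x as. F (as ! 0))"
    by (rule computable_cong[OF *]) (simp only: eq)
qed

section \<open>Halving and pairing\<close>

lemma computable_parity [computable_intros]:
  assumes "computable k A"
  shows "computable k (\<lambda>x as. of_bool (even (A x as)))"
proof -
  have *: "computable k (\<lambda>x as. rec_nat 1 (\<lambda>_ b. 1 - b) (A x as))"
    by (intro computable_intros assms) simp_all
  have eq: "rec_nat 1 (\<lambda>_ b. 1 - b) n = (of_bool (even n) :: nat)" for n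
    by (induction n) auto
  show ?thesis by (rule computable_cong[OF *]) (simp only: eq)
qed

lemma computable_half [computable_intros]:
  assumes "computable k A"
  shows "computable k (\<lambda>x as. A x as div 2)"
proof -
  have *: "computable k (\<lambda>x as. rec_nat 0 (\<lambda>n b. if even n then b else Suc b) (A x as))"
    by (intro computable_intros assms) simp_all
  have eq: "rec_nat 0 (\<lambda>n b. if even n then b else Suc b) n = n div 2" for n
    by (induction n) auto
  show ?thesis by (rule computable_cong[OF *]) (simp only: eq)
qed

lemma computable_triangle [computable_intros]:
  assumes "computable k A"
  shows "computable k (\<lambda>x as. triangle (A x as))"
proof -
  have *: "computable k (\<lambda>x as. rec_nat 0 (\<lambda>n b. b + Suc n) (A x as))"
    by (intro computable_intros assms) simp_all
  have eq: "rec_nat 0 (\<lambda>n b. b + Suc n) n = triangle n" for n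
    by (induction n) auto
  show ?thesis by (rule computable_cong[OF *]) (simp only: eq)
qed

lemma computable_prod_encode [computable_intros]:
  assumes "computable k A" "computable k B"
  shows "computable k (\<lambda>x as. prod_encode (A x as, B x as))"
  unfolding prod_encode_def by (simp, intro computable_intros assms)

text \<open>The index of the diagonal containing \<open>n\<close>, i.e. the sum of the components of \<^term>\<open>prod_decode n\<close>.\<close>

primrec diagonal :: "nat \<Rightarrow> nat" where
  "diagonal 0 = 0"
| "diagonal (Suc n) = (if triangle (Suc (diagonal n)) = Suc n then Suc (diagonal n) else diagonal n)"

lemma diagonal_bounds: "triangle (diagonal n) \<le> n \<and> n \<le> triangle (diagonal n) + diagonal n"
  by (induction n) (auto split: if_splits)

text \<open>By \<open>diagonal_bounds\<close> the truncated subtractions are exact, so the pair on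
  the right encodes to \<open>n\<close>. The closed form makes both components of
  \<open>prod_decode\<close> computable.\<close>

lemma prod_decode_diagonal:
  "prod_decode n = (n - triangle (diagonal n), diagonal n - (n - triangle (diagonal n)))"
  (is "_ = ?p")
proof -
  have "prod_encode ?p = n" using diagonal_bounds[of n] by (simp add: prod_encode_def)
  then show ?thesis by (metis prod_encode_inverse)
qed

lemma computable_diagonal [computable_intros]:
  assumes "computable k A"
  shows "computable k (\<lambda>x as. diagonal (A x as))"
  unfolding diagonal_def
  by (intro computable_intros assms) simp_all

section \<open>Embeddings of the full binary tree\<close>

text \<open>Reduces a condition on all pairs of strings to one on parents and siblings, which a tree
  of finite approximations can check.\<close>

lemma prefix_embedding:
  fixes s :: "bool list \<Rightarrow> bool list"
  assumes ext: "\<And>\<tau> b. strict_prefix (s \<tau>) (s (\<tau> @ [b]))"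
    and par: "\<And>\<tau>. s (\<tau> @ [False]) \<parallel> s (\<tau> @ [True])"
  shows "prefix (s \<sigma>) (s \<tau>) \<longleftrightarrow> prefix \<sigma> \<tau>"
proof
  have mono: "prefix (s \<sigma>) (s (\<sigma> @ \<rho>))" for \<sigma> \<rho>
  proof (induction \<rho> rule: rev_induct)
    case (snoc b \<rho>)
    then show ?case using ext[of "\<sigma> @ \<rho>" b] by (auto dest: prefix_order.trans simp: strict_prefix_def)
  qed simp
  then show "prefix \<sigma> \<tau> \<Longrightarrow> prefix (s \<sigma>) (s \<tau>)" by (auto elim: prefixE)
  assume pre: "prefix (s \<sigma>) (s \<tau>)"
  show "prefix \<sigma> \<tau>"
  proof (rule ccontr)
    assume "\<not> prefix \<sigma> \<tau>"
    then consider "strict_prefix \<tau> \<sigma>" | "\<sigma> \<parallel> \<tau>" by (auto simp: strict_prefix_def)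
    then show False
    proof cases
      case 1
      then obtain b \<rho> where "\<sigma> = (\<tau> @ [b]) @ \<rho>" by (auto elim: strict_prefixE')
      then have "prefix (s (\<tau> @ [b])) (s \<sigma>)" using mono by blast
      then show False using pre ext[of \<tau> b]
        by (meson prefix_order.less_le_not_le prefix_order.trans)
    next
      case 2
      \<comment> \<open>The two strings part at \<open>\<nu>\<close>. Both children of
        \<open>\<nu>\<close> would have images below \<open>s \<tau>\<close>, hence comparable
        ones.\<close>
      then obtain \<nu> b c \<rho> \<rho>' where *: "b \<noteq> c" "\<sigma> = \<nu> @ b # \<rho>" "\<tau> = \<nu> @ c # \<rho>'"
        using parallel_decomp[OF 2] by auto
      have "prefix (s (\<nu> @ [b])) (s \<tau>)" "prefix (s (\<nu> @ [c])) (s \<tau>)"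
        using mono[of "\<nu> @ [b]" \<rho>] mono[of "\<nu> @ [c]" \<rho>'] pre * by (auto dest: prefix_order.trans)
      then have "\<not> s (\<nu> @ [b]) \<parallel> s (\<nu> @ [c])" by (auto dest: prefix_same_cases)
      then show False using par[of \<nu>] \<open>b \<noteq> c\<close> by (cases b; cases c) auto
    qed
  qed
qed

lemma prefix_isomorphic_range:
  fixes s :: "bool list \<Rightarrow> bool list"
  assumes "\<And>\<sigma> \<tau>. prefix (s \<sigma>) (s \<tau>) \<longleftrightarrow> prefix \<sigma> \<tau>"
  shows "range s \<cong>\<^sub>p UNIV"
proof -
  have inj: "inj s" using assms by (metis injI prefix_order.antisym prefix_order.refl)
  then have "bij_betw (inv s) (range s) UNIV"
    by (simp add: bij_betw_inv_into inj_imp_bij_betw_inv inj_on_imp_bij_betw)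
  then show ?thesis unfolding prefix_isomorphic_def using assms inj by auto
qed

lemma prefix_isomorphic_UNIV_embedding:
  assumes "H \<cong>\<^sub>p UNIV" "\<sigma> \<in> H"
  obtains s :: "bool list \<Rightarrow> bool list" where "s [] = \<sigma>" "\<And>\<tau>. s \<tau> \<in> H" "\<And>\<rho> \<tau>. prefix (s \<rho>) (s \<tau>) \<longleftrightarrow> prefix \<rho> \<tau>"
proof -
  obtain h :: "bool list \<Rightarrow> bool list" where h: "bij_betw h H UNIV" "\<And>\<sigma> \<tau>. \<sigma> \<in> H \<Longrightarrow> \<tau> \<in> H \<Longrightarrow> prefix \<sigma> \<tau> \<longleftrightarrow> prefix (h \<sigma>) (h \<tau>)"
    using assms(1) unfolding prefix_isomorphic_def by auto
  \<comment> \<open>The part of \<open>H\<close> above \<open>\<sigma>\<close> corresponds under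
    \<open>h\<close> to the strings extending \<open>h \<sigma>\<close>, again a full binary
    tree.\<close>
  define s where "s \<tau> = inv_into H h (h \<sigma> @ \<tau>)" for \<tau>
  have mem: "s \<tau> \<in> H" and hs: "h (s \<tau>) = h \<sigma> @ \<tau>" for \<tau>
    using h(1) unfolding s_def by (auto simp: bij_betw_def inv_into_into f_inv_into_f)
  show thesis
  proof
    show "s [] = \<sigma>" using h(1) assms(2) unfolding s_def by (simp add: bij_betw_def)
    show "s \<tau> \<in> H" for \<tau> by (rule mem)
    show "prefix (s \<rho>) (s \<tau>) \<longleftrightarrow> prefix \<rho> \<tau>" for \<rho> \<tau>
      using h(2)[OF mem mem] by (simp add: hs)
  qed
qed

section \<open>Binary strings as numbers, and embeddings as sequences of numbers\<close>

definition bin_decode :: "nat \<Rightarrow> bool list" where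
  "bin_decode = inv bin_encode"

lemma bin_decode_encode [simp]: "bin_decode (bin_encode \<sigma>) = \<sigma>"
  unfolding bin_decode_def using bij_bin_encode by (simp add: bij_is_inj)

lemma bin_encode_decode [simp]: "bin_encode (bin_decode n) = n"
  unfolding bin_decode_def using bij_bin_encode by (simp add: bij_is_surj surj_f_inv_f)

lemma bin_encode_eq_iff [simp]: "bin_encode \<sigma> = bin_encode \<tau> \<longleftrightarrow> \<sigma> = \<tau>"
  by (metis bin_decode_encode)

lemma bin_decode_eq_iff [simp]: "bin_decode a = bin_decode b \<longleftrightarrow> a = b"
  by (metis bin_encode_decode)

lemma bin_encode_append: "bin_encode (\<sigma> @ \<tau>) = bin_encode \<sigma> + 2 ^ length \<sigma> * bin_encode \<tau>"
  by (induction \<sigma>) (auto simp: algebra_simps)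

lemma bin_decode_0: "bin_decode 0 = []"
  by (metis bin_decode_encode bin_encode.simps(1))

lemma bin_decode_pos: "n > 0 \<Longrightarrow> bin_decode n = even n # bin_decode ((n - 1) div 2)"
proof -
  assume "n > 0"
  then have "n = bin_encode (even n # bin_decode ((n - 1) div 2))" by simp presburger
  then show ?thesis by (metis bin_decode_encode)
qed

definition bin_prefix :: "nat \<Rightarrow> nat \<Rightarrow> bool" where
  "bin_prefix a b \<longleftrightarrow> prefix (bin_decode a) (bin_decode b)"

text \<open>The digits are written with the least significant first, so appending a string with code
  \<open>c\<close> adds \<open>c\<close> times a power of 2. As \<open>c\<close> is at most
  \<open>b\<close>, a bounded search decides the relation.\<close>

lemma bin_prefix_iff: "bin_prefix a b \<longleftrightarrow> (\<exists>c<Suc b. b = a + 2 ^ length (bin_decode a) * c)"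
proof
  assume "bin_prefix a b"
  then obtain \<rho> where "bin_decode b = bin_decode a @ \<rho>" unfolding bin_prefix_def by (blast elim: prefixE)
  then have b: "b = a + 2 ^ length (bin_decode a) * bin_encode \<rho>"
    by (metis bin_encode_append bin_encode_decode)
  then have "1 * bin_encode \<rho> \<le> b"
    by (metis le_add2 le_trans mult_le_mono1 one_le_numeral one_le_power)
  with b show "\<exists>c<Suc b. b = a + 2 ^ length (bin_decode a) * c" by (auto simp: less_Suc_eq_le)
next
  assume "\<exists>c<Suc b. b = a + 2 ^ length (bin_decode a) * c"
  then obtain c where "b = a + 2 ^ length (bin_decode a) * c" by blast
  then have "b = bin_encode (bin_decode a @ bin_decode c)" by (simp add: bin_encode_append)
  then show "bin_prefix a b" unfolding bin_prefix_def by simp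
qed

text \<open>
  \<open>g n\<close> codes the image of the string with code \<open>n\<close> read backwards; in this order the
  children of \<open>n\<close> are \<open>2n + 1\<close> and \<open>2n + 2\<close>.
\<close>

definition embedding_step :: "(nat \<Rightarrow> nat) \<Rightarrow> nat \<Rightarrow> bool" where
  "embedding_step g n \<longleftrightarrow>
     (0 < n \<longrightarrow> g ((n - 1) div 2) \<noteq> g n \<and> bin_prefix (g ((n - 1) div 2)) (g n)) \<and>
     (0 < n \<and> even n \<longrightarrow> \<not> bin_prefix (g (n - 1)) (g n) \<and> \<not> bin_prefix (g n) (g (n - 1)))"

lemma embedding_exists_iff:
  "(\<exists>H. H \<cong>\<^sub>p UNIV \<and> monochromatic f H \<and> \<sigma> \<in> H) \<longleftrightarrow>
   (\<exists>g. g 0 = bin_encode \<sigma> \<and> (\<forall>n. f (bin_decode (g n)) = f \<sigma> \<and> embedding_step g n))"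
  (is "?L \<longleftrightarrow> ?R")
proof
  assume ?L
  then obtain H where H: "H \<cong>\<^sub>p UNIV" "monochromatic f H" "\<sigma> \<in> H" by blast
  obtain s :: "bool list \<Rightarrow> bool list" where s: "s [] = \<sigma>" "\<And>\<tau>. s \<tau> \<in> H" "\<And>\<rho> \<tau>. prefix (s \<rho>) (s \<tau>) \<longleftrightarrow> prefix \<rho> \<tau>"
    using prefix_isomorphic_UNIV_embedding[OF H(1,3)] by metis
  have inj: "s \<rho> = s \<tau> \<longleftrightarrow> \<rho> = \<tau>" for \<rho> \<tau> by (metis s(3) prefix_order.antisym prefix_order.refl)
  define g where "g n = bin_encode (s (rev (bin_decode n)))" for n
  have col: "f (bin_decode (g n)) = f \<sigma>" for n
    using H(2,3) s(2) unfolding monochromatic_def g_def by auto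
  have "embedding_step g n" for n
  proof -
    have "g ((n - 1) div 2) \<noteq> g n \<and> bin_prefix (g ((n - 1) div 2)) (g n)" if "n > 0"
      using bin_decode_pos[OF that] unfolding g_def bin_prefix_def by (simp add: s(3) inj)
    moreover have "\<not> bin_prefix (g (n - 1)) (g n) \<and> \<not> bin_prefix (g n) (g (n - 1))"
      if "0 < n" "even n"
    proof -
      \<comment> \<open>A positive even \<open>n\<close> is a \<open>True\<close> child, and
        \<open>n - 1\<close> is its \<open>False\<close> sibling.\<close>
      from that obtain m where "n = 2 * Suc m" by (metis dvdE gr0_conv_Suc mult_is_0 not_gr0)
      then have "bin_decode (n - 1) = False # bin_decode m" "bin_decode n = True # bin_decode m"
        using bin_decode_pos[of "n - 1"] bin_decode_pos[of n] by auto
      then show ?thesis unfolding g_def bin_prefix_def by (simp add: s(3))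
    qed
    ultimately show ?thesis unfolding embedding_step_def by blast
  qed
  moreover have "g 0 = bin_encode \<sigma>" by (simp add: g_def bin_decode_0 s(1))
  ultimately show ?R using col by blast
next
  assume ?R
  then obtain g where g0: "g 0 = bin_encode \<sigma>" and col: "\<And>n. f (bin_decode (g n)) = f \<sigma>"
    and step: "\<And>n. embedding_step g n" by blast
  define s where "s \<tau> = bin_decode (g (bin_encode (rev \<tau>)))" for \<tau>
  have "strict_prefix (s \<tau>) (s (\<tau> @ [b]))" for \<tau> b
    using step[of "bin_encode (b # rev \<tau>)"]
    unfolding embedding_step_def bin_prefix_def s_def strict_prefix_def
    by (cases b) auto
  moreover have "s (\<tau> @ [False]) \<parallel> s (\<tau> @ [True])" for \<tau>
    using step[of "bin_encode (True # rev \<tau>)"]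
    unfolding embedding_step_def bin_prefix_def s_def by auto
  ultimately have "range s \<cong>\<^sub>p UNIV" by (intro prefix_isomorphic_range prefix_embedding)
  moreover have "monochromatic f (range s)" unfolding monochromatic_def s_def using col by auto
  moreover have "s [] = \<sigma>" by (simp add: s_def g0)
  ultimately show ?L by (metis rangeI)
qed

text \<open>\<open>P g n\<close> depends on \<open>g\<close> only up to index \<open>n\<close>, so
  it does not see where a list ends and passes to prefixes.\<close>

lemma is_tree_local:
  fixes P :: "(nat \<Rightarrow> nat) \<Rightarrow> nat \<Rightarrow> bool"
  assumes "\<And>g g' n. (\<And>i. i \<le> n \<Longrightarrow> g i = g' i) \<Longrightarrow> P g n \<Longrightarrow> P g' n"
  shows "is_tree {\<tau>. \<forall>n<length \<tau>. P ((!) \<tau>) n}"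
  unfolding is_tree_def
proof (intro ballI allI impI CollectI)
  fix \<tau> \<sigma> :: "nat list" and n
  assume "\<tau> \<in> {\<tau>. \<forall>n<length \<tau>. P ((!) \<tau>) n}" "prefix \<sigma> \<tau>" "n < length \<sigma>"
  then show "P ((!) \<sigma>) n"
    by (intro assms[of n "(!) \<tau>" "(!) \<sigma>"]) (auto simp: nth_append elim!: prefixE)
qed

lemma has_infinite_path_local:
  fixes P :: "(nat \<Rightarrow> nat) \<Rightarrow> nat \<Rightarrow> bool"
  assumes P: "\<And>g g' n. (\<And>i. i \<le> n \<Longrightarrow> g i = g' i) \<Longrightarrow> P g n \<Longrightarrow> P g' n"
  shows "has_infinite_path {\<tau>. \<forall>n<length \<tau>. P ((!) \<tau>) n} \<longleftrightarrow> (\<exists>g. \<forall>n. P g n)"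
proof -
  have "(\<forall>m. \<forall>n<m. P ((!) (map g [0..<m])) n) \<longleftrightarrow> (\<forall>n. P g n)" for g
  proof (intro iffI allI impI)
    fix n :: nat assume "\<forall>m. \<forall>n<m. P ((!) (map g [0..<m])) n"
    then have "P ((!) (map g [0..<Suc n])) n" by blast
    then show "P g n" by (rule P[rotated]) (simp del: upt_Suc)
  next
    fix n m :: nat assume "\<forall>n. P g n" "n < m"
    then have "P g n" by blast
    then show "P ((!) (map g [0..<m])) n" by (rule P[rotated]) (use \<open>n < m\<close> in simp)
  qed
  then show ?thesis unfolding has_infinite_path_def by simp
qed

section \<open>The colouring of a tree\<close>

text \<open>
  The string \<open>0\<^sup>a 1 0\<^sup>b 1 \<dots> 1 0\<^sup>m\<close> has the blocks \<open>a, b, \<dots>\<close>; the unfinished last block is dropped.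
\<close>

fun blocks :: "bool list \<Rightarrow> nat list" where
  "blocks [] = []"
| "blocks (True # \<rho>) = 0 # blocks \<rho>"
| "blocks (False # \<rho>) = (case blocks \<rho> of [] \<Rightarrow> [] | a # as \<Rightarrow> Suc a # as)"

text \<open>Further bits fill the unfinished block and open new ones, but leave the finished blocks
  alone.\<close>

lemma blocks_append: "\<exists>as. blocks (\<rho> @ \<rho>') = blocks \<rho> @ as"
  by (induction \<rho> rule: blocks.induct) (auto split: list.splits)

lemma blocks_snoc_True: "blocks (\<rho> @ [True]) \<noteq> []"
  by (induction \<rho> rule: blocks.induct) (auto split: list.splits)

lemma blocks_append_Cons_True: "blocks (\<rho> @ True # \<rho>') = blocks (\<rho> @ [True]) @ blocks \<rho>'"
  by (induction \<rho> rule: blocks.induct) (auto split: list.splits simp: blocks_snoc_True)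

lemma blocks_replicate: "blocks (replicate a False @ [True]) = [a]"
  by (induction a) auto

lemma length_blocks_snoc_True: "length (blocks \<rho>) < length (blocks (\<rho> @ [True]))"
  by (induction \<rho> rule: blocks.induct) (auto split: list.splits)

definition block_string :: "nat list \<Rightarrow> bool list" where
  "block_string as = concat (map (\<lambda>a. replicate a False @ [True]) as)"

lemma blocks_block_string: "blocks (block_string as) = as"
proof (induction as)
  case (Cons a as)
  have "blocks (block_string (a # as)) = blocks (replicate a False @ True # block_string as)"
    by (simp add: block_string_def)
  then show ?case
    using Cons blocks_append_Cons_True[of "replicate a False" "block_string as"] by (simp add: blocks_replicate)
qed (simp add: block_string_def)

text \<open>
  Halving the blocks gives every path of \<open>T\<close> two choices at each level, so that a single path
  already yields a full binary tree.  The root is coloured 1 even if \<open>T\<close> is empty, since otherwise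
  the colouring would be constant.
\<close>

definition tree_coloring :: "nat list set \<Rightarrow> bool list \<Rightarrow> nat" where
  "tree_coloring T \<rho> = (if \<rho> = [] \<or> map (\<lambda>a. a div 2) (blocks \<rho>) \<in> T then 1 else 0)"

lemma infinite_path_imp_embedding:
  assumes "has_infinite_path T"
  shows "\<exists>H. H \<cong>\<^sub>p UNIV \<and> monochromatic (tree_coloring T) H \<and> [] \<in> H"
proof -
  obtain g where g: "\<And>n. map g [0..<n] \<in> T" using assms unfolding has_infinite_path_def by blast
  \<comment> \<open>The bit at level \<open>i\<close> chooses between the two numbers whose half is
    \<open>g i\<close>.\<close>
  define a where "a \<tau> = map (\<lambda>i. 2 * g i + of_bool (\<tau> ! i)) [0..<length \<tau>]" for \<tau>
  define s where "s \<tau> = block_string (a \<tau>)" for \<tau>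
  have "a (\<tau> @ [b]) = a \<tau> @ [2 * g (length \<tau>) + of_bool b]" for \<tau> b
    by (simp add: a_def nth_append)
  then have snoc: "s (\<tau> @ [b]) = s \<tau> @ replicate (2 * g (length \<tau>) + of_bool b) False @ [True]" for \<tau> b
    by (simp add: s_def block_string_def)
  have "strict_prefix (s \<tau>) (s (\<tau> @ [b]))" for \<tau> b
    by (simp add: snoc strict_prefix_def)
  \<comment> \<open>Beyond \<open>s \<tau>\<close> the two strings first differ after
    \<open>2 * g (length \<tau>)\<close> zeros, where one has a 1 and the other a further 0.\<close>
  moreover have "s (\<tau> @ [False]) \<parallel> s (\<tau> @ [True])" for \<tau>
    by (auto simp: snoc intro!: parallelI simp flip: replicate_append_same)
  ultimately have "range s \<cong>\<^sub>p UNIV" by (intro prefix_isomorphic_range prefix_embedding)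
  moreover have "map (\<lambda>a. a div 2) (blocks (s \<tau>)) = map g [0..<length \<tau>]" for \<tau>
    by (simp add: s_def blocks_block_string a_def)
  then have "monochromatic (tree_coloring T) (range s)"
    unfolding monochromatic_def tree_coloring_def by (auto simp: g)
  moreover have "s [] = []" by (simp add: s_def a_def block_string_def)
  ultimately show ?thesis by (metis rangeI)
qed

text \<open>
  Of two incomparable extensions of a node at least one contains a 1 beyond the node, so the
  sequence of blocks grows along a suitable chain.
\<close>

lemma embedding_imp_infinite_path:
  assumes T: "is_tree T"
    and H: "H \<cong>\<^sub>p UNIV" "monochromatic (tree_coloring T) H" "[] \<in> H"
  shows "has_infinite_path T"
proof -
  obtain s :: "bool list \<Rightarrow> bool list" where s: "s [] = []" "\<And>\<tau>. s \<tau> \<in> H" "\<And>\<rho> \<tau>. prefix (s \<rho>) (s \<tau>) \<longleftrightarrow> prefix \<rho> \<tau>"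
    using prefix_isomorphic_UNIV_embedding[OF H(1,3)] by metis
  \<comment> \<open>The root is in \<open>H\<close> and has colour 1, so all of \<open>H\<close>
    has. For nonempty strings this means membership in \<open>T\<close>.\<close>
  have "tree_coloring T (s \<tau>) = tree_coloring T []" for \<tau>
    using H(2) s(2) H(3) unfolding monochromatic_def by metis
  then have mem: "map (\<lambda>a. a div 2) (blocks (s \<tau>)) \<in> T" if "s \<tau> \<noteq> []" for \<tau>
    using that unfolding tree_coloring_def by (metis zero_neq_one)
  have "\<exists>b. length (blocks (s \<tau>)) < length (blocks (s (\<tau> @ [b])))" for \<tau>
  proof -
    obtain \<rho> \<rho>' where \<rho>: "s (\<tau> @ [False]) = s \<tau> @ \<rho>" "s (\<tau> @ [True]) = s \<tau> @ \<rho>'"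
      by (metis prefixE prefixI s(3))
    have "\<not> prefix \<rho> \<rho>'" "\<not> prefix \<rho>' \<rho>"
      using s(3)[of "\<tau> @ [False]" "\<tau> @ [True]"] s(3)[of "\<tau> @ [True]" "\<tau> @ [False]"] \<rho> by auto
    \<comment> \<open>Strings of zeros are comparable, so the incomparable \<open>\<rho>\<close> and
      \<open>\<rho>'\<close> cannot both be of this form.\<close>
    moreover have "\<mu> = replicate (length \<mu>) False" if "True \<notin> set \<mu>" for \<mu>
      using that by (induction \<mu>) auto
    moreover have "prefix (replicate m False) (replicate n False)" if "m \<le> n" for m n
      using that by (metis le_add_diff_inverse prefixI replicate_add)
    ultimately have "True \<in> set \<rho> \<or> True \<in> set \<rho>'"
      by (metis linorder_le_cases)
    moreover have "length (blocks (s \<tau>)) < length (blocks (s \<tau> @ \<rho>))" if "True \<in> set \<rho>" for \<rho>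
    proof -
      obtain \<mu> \<nu> where \<rho>: "\<rho> = \<mu> @ True # \<nu>" using \<open>True \<in> set \<rho>\<close> by (meson split_list)
      have "length (blocks (s \<tau>)) \<le> length (blocks (s \<tau> @ \<mu>))"
        using blocks_append[of "s \<tau>" \<mu>] by auto
      also have "\<dots> < length (blocks ((s \<tau> @ \<mu>) @ [True]))" by (rule length_blocks_snoc_True)
      also have "\<dots> \<le> length (blocks (s \<tau> @ \<rho>))"
        using blocks_append[of "(s \<tau> @ \<mu>) @ [True]" \<nu>] by (auto simp: \<rho>)
      finally show ?thesis .
    qed
    ultimately show ?thesis using \<rho> by metis
  qed
  then obtain b where b: "\<And>\<tau>. length (blocks (s \<tau>)) < length (blocks (s (\<tau> @ [b \<tau>])))" by metis
  define c where "c = rec_nat [] (\<lambda>_ \<tau>. \<tau> @ [b \<tau>])"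
  define A where "A n = map (\<lambda>a. a div 2) (blocks (s (c n)))" for n
  have len: "n \<le> length (A n)" for n
  proof (induction n)
    case (Suc n)
    then show ?case using b[of "c n"] by (simp add: A_def c_def)
  qed simp
  \<comment> \<open>The index starts at 1 because \<open>A 0\<close> comes from the root, whose
    colour says nothing about \<open>T\<close>.\<close>
  have AT: "A (Suc n) \<in> T" for n
    unfolding A_def using len[of "Suc n"] by (intro mem) (auto simp: A_def)
  have A_step: "prefix (A n) (A (Suc n))" for n
  proof -
    have "prefix (s (c n)) (s (c (Suc n)))" by (simp add: s(3) c_def)
    then obtain \<rho> where "s (c (Suc n)) = s (c n) @ \<rho>" by (blast elim: prefixE)
    then show ?thesis using blocks_append[of "s (c n)" \<rho>] by (auto simp: A_def)
  qed
  have mono: "prefix (A m) (A n)" if "m \<le> n" for m n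
    using that
  proof (induction rule: dec_induct)
    case (step n)
    then show ?case using A_step by (blast intro: prefix_order.trans)
  qed simp
  have nth: "A m ! i = A n ! i" if "i < length (A m)" "m \<le> n" for i m n
    using mono[OF that(2)] that(1) by (auto elim!: prefixE simp: nth_append)
  \<comment> \<open>The lists \<open>A n\<close> form a chain with unbounded lengths; their common
    limit is the path. The entry \<open>i\<close> exists in \<open>A (Suc i)\<close> by
    \<open>len\<close>.\<close>
  have "map (\<lambda>i. A (Suc i) ! i) [0..<n] = take n (A (Suc n))" for n
  proof (rule nth_equalityI)
    show "length (map (\<lambda>i. A (Suc i) ! i) [0..<n]) = length (take n (A (Suc n)))"
      using len[of "Suc n"] by simp
    fix i assume i: "i < length (map (\<lambda>i. A (Suc i) ! i) [0..<n])"
    then show "map (\<lambda>i. A (Suc i) ! i) [0..<n] ! i = take n (A (Suc n)) ! i"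
      using nth[of i "Suc i" "Suc n"] len[of "Suc i"] by simp
  qed
  moreover have "take n (A (Suc n)) \<in> T" for n
    using T AT take_is_prefix unfolding is_tree_def by blast
  ultimately show ?thesis unfolding has_infinite_path_def by metis
qed

section \<open>Computability of the codings\<close>

text \<open>The subtraction undoes the \<open>Suc\<close> in the code of a nonempty list. At 0 it is
  truncated, which makes 0 a fixed point of \<open>list_tl\<close>, as
  \<open>computable_wf_rec\<close> demands.\<close>

definition list_hd :: "nat \<Rightarrow> nat" where "list_hd n = fst (prod_decode (n - 1))"
definition list_tl :: "nat \<Rightarrow> nat" where "list_tl n = snd (prod_decode (n - 1))"

lemma list_decode_pos: "n > 0 \<Longrightarrow> list_decode n = list_hd n # list_decode (list_tl n)"
  by (cases n) (auto simp: list_hd_def list_tl_def split: prod.split)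

lemma list_tl_less: "n > 0 \<Longrightarrow> list_tl n < n"
  unfolding list_tl_def by (metis Suc_pred' le_imp_less_Suc le_prod_encode_2 prod.collapse prod_decode_inverse)

lemma list_tl_0: "list_tl 0 = 0"
  by (simp add: list_tl_def prod_decode_diagonal)

lemma computable_list_hd [computable_intros]:
  assumes "computable k A"
  shows "computable k (\<lambda>x as. list_hd (A x as))"
  unfolding list_hd_def prod_decode_diagonal fst_conv
  by (intro computable_intros assms)

lemma computable_list_tl [computable_intros]:
  assumes "computable k A"
  shows "computable k (\<lambda>x as. list_tl (A x as))"
  unfolding list_tl_def prod_decode_diagonal snd_conv
  by (intro computable_intros assms)

lemma computable_length_list_decode [computable_intros]:
  assumes "computable k A"
  shows "computable k (\<lambda>x as. length (list_decode (A x as)))"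
proof (rule computable_wf_rec[where t = list_tl and G = "\<lambda>n. Suc", OF _ list_tl_0 list_tl_less _ _ assms])
  show "length (list_decode n) = Suc (length (list_decode (list_tl n)))" if "n > 0" for n
    by (simp add: list_decode_pos[OF that])
qed (auto intro!: computable_intros)

lemma list_decode_nth: "i < length (list_decode n) \<Longrightarrow> list_decode n ! i = list_hd ((list_tl ^^ i) n)"
proof (induction i arbitrary: n)
  case 0
  then have "n > 0" by (cases n) auto
  then show ?case by (simp add: list_decode_pos)
next
  case (Suc i)
  then have n: "n > 0" by (cases n) auto
  show ?case using Suc by (simp add: list_decode_pos[OF n] funpow_swap1)
qed

lemma computable_map_list_decode:
  fixes h :: "nat \<Rightarrow> nat"
  assumes h: "computable (Suc 0) (\<lambda>x as. h (as ! 0))" and A: "computable k A"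
  shows "computable k (\<lambda>x as. list_encode (map h (list_decode (A x as))))"
proof (rule computable_wf_rec[where t = list_tl and G = "\<lambda>n r. Suc (prod_encode (h (list_hd n), r))",
      OF _ list_tl_0 list_tl_less _ _ A])
  show "list_encode (map h (list_decode n)) =
      Suc (prod_encode (h (list_hd n), list_encode (map h (list_decode (list_tl n)))))" if "n > 0" for n
    by (simp add: list_decode_pos[OF that])
qed (auto intro!: computable_intros computable_subst1[where F = "\<lambda>_. h", OF h])

text \<open>The map from \<open>n\<close> to \<open>(n - 1) div 2\<close> removes the first bit,
  which is 1 exactly for positive even \<open>n\<close>. The test \<open>r = 0\<close> asks whether
  the remaining string has no finished block.\<close>

lemma computable_blocks [computable_intros]:
  assumes "computable k A"
  shows "computable k (\<lambda>x as. list_encode (blocks (bin_decode (A x as))))"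
proof (rule computable_wf_rec[where t = "\<lambda>n. (n - 1) div 2" and
      G = "\<lambda>n r. if even n then Suc (prod_encode (0, r)) else if r = 0 then 0
        else Suc (prod_encode (Suc (list_hd r), list_tl r))", OF _ _ _ _ _ assms])
  let ?r = "\<lambda>n. list_encode (blocks (bin_decode ((n - 1) div 2)))"
  show "list_encode (blocks (bin_decode n)) = (if even n then Suc (prod_encode (0, ?r n))
      else if ?r n = 0 then 0 else Suc (prod_encode (Suc (list_hd (?r n)), list_tl (?r n))))" if "n > 0" for n
    by (auto simp: bin_decode_pos[OF that] list_hd_def list_tl_def split: list.split)
qed (auto intro!: computable_intros)

lemma computable_bin_power:
  assumes "computable k A"
  shows "computable k (\<lambda>x as. (2 :: nat) ^ length (bin_decode (A x as)))"
proof (rule computable_wf_rec[where t = "\<lambda>n. (n - 1) div 2" and G = "\<lambda>n r. 2 * r", OF _ _ _ _ _ assms])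
  show "(2 :: nat) ^ length (bin_decode n) = 2 * 2 ^ length (bin_decode ((n - 1) div 2))" if "n > 0" for n
    by (simp add: bin_decode_pos[OF that])
qed (auto intro!: computable_intros)

lemma computable_bin_prefix [computable_intros]:
  assumes "computable k A" "computable k B"
  shows "computable k (\<lambda>x as. of_bool (bin_prefix (A x as) (B x as)))"
proof (rule computable_subst2[where F = "\<lambda>_ a b. of_bool (bin_prefix a b)", OF _ assms])
  show "computable (Suc (Suc 0)) (\<lambda>x as. of_bool (bin_prefix (as ! 0) (as ! 1)))"
    unfolding bin_prefix_iff by (intro computable_intros computable_bin_power) simp_all
qed

section \<open>The two reductions\<close>

lemma code_nat_eq_iff [simp]: "code_nat m = code_nat n \<longleftrightarrow> m = n"
  unfolding code_nat_def by (metis (full_types))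

lemma join_eq_iff [simp]: "x \<oplus> y = x' \<oplus> y' \<longleftrightarrow> x = x' \<and> y = y'"
proof
  assume eq: "x \<oplus> y = x' \<oplus> y'"
  have "x n = x' n \<and> y n = y' n" for n
    using fun_cong[OF eq, of "2 * n"] fun_cong[OF eq, of "Suc (2 * n)"] by (simp add: join_def)
  then show "x = x' \<and> y = y'" by auto
qed simp

lemma code_coloring_eq_iff [simp]: "code_coloring f = code_coloring f' \<longleftrightarrow> f = f'"
proof
  assume "code_coloring f = code_coloring f'"
  then show "f = f'"
    unfolding code_coloring_def by (metis bin_decode_def bin_decode_encode ext)
qed simp

lemma code_tree_eq_iff [simp]: "code_tree T = code_tree T' \<longleftrightarrow> T = T'"
proof
  assume eq: "code_tree T = code_tree T'"
  have "\<tau> \<in> T \<longleftrightarrow> \<tau> \<in> T'" for \<tau>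
    using fun_cong[OF eq, of "list_encode \<tau>"] by (auto simp: code_tree_def split: if_splits)
  then show "T = T'" by blast
qed simp

lemma WF_problem_code_tree:
  "WF_problem (code_tree T) =
     (if is_tree T then {code_nat (if has_infinite_path T then 0 else 1)} else {})"
  unfolding WF_problem_def by auto

lemma TT1_Ext_code:
  "TT1_Ext k (code_coloring f \<oplus> code_nat (bin_encode \<sigma>)) =
     (if range f \<subseteq> {..<k} then
        {code_nat (if \<exists>H. H \<cong>\<^sub>p UNIV \<and> monochromatic f H \<and> \<sigma> \<in> H then 1 else 0)} else {})"
  unfolding TT1_Ext_def by auto

text \<open>Only the forward functional depends on the problems; the backward one flips the
  answer.\<close>

lemma weihrauch_le_complement:
  assumes F: "computable 1 F"
    and P: "\<And>x. is_instance P x \<Longrightarrow> \<exists>b. P x = {code_nat (of_bool b)} \<and>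
      Q (\<lambda>n. F x [n]) = {code_nat (of_bool (\<not> b))}"
  shows "P \<le>\<^sub>W Q"
proof -
  \<comment> \<open>In a joined oracle, position 1 holds the first entry of the second half, which
    is the answer to be flipped.\<close>
  define G :: "baire \<Rightarrow> nat list \<Rightarrow> nat" where "G = (\<lambda>x as. if as ! 0 = 0 then 1 - x 1 else 0)"
  have "computable 1 G" unfolding G_def by (intro computable_intros) simp_all
  note G = turing_functional_computable[OF this]
  have G_eq: "(\<lambda>n. G (x \<oplus> code_nat (of_bool (\<not> b))) [n]) = code_nat (of_bool b)" for x b
    by (auto simp: G_def join_def code_nat_def)
  have "is_instance Q (\<lambda>n. F x [n]) \<and>
      (\<forall>y\<in>Q (\<lambda>n. F x [n]). (\<lambda>n. G (x \<oplus> y) [n]) \<in> P x)" if inst: "is_instance P x" for x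
  proof -
    obtain b where b: "P x = {code_nat (of_bool b)}" "Q (\<lambda>n. F x [n]) = {code_nat (of_bool (\<not> b))}"
      using P[OF inst] by blast
    show ?thesis unfolding b is_instance_def by (simp only: ball_simps G_eq) simp
  qed
  then show ?thesis
    unfolding weihrauch_le_def using turing_functional_computable[OF F] G
    by (intro exI[of _ "\<lambda>x. Some (\<lambda>n. F x [n])"] exI[of _ "\<lambda>x. Some (\<lambda>n. G x [n])"]) simp
qed

text \<open>The odd half of an instance \<open>x\<close> of \<^term>\<open>TT1_Ext k\<close> starts with the code of the string.\<close>

definition embedding_tree :: "baire \<Rightarrow> nat list set" where
  "embedding_tree x = {\<tau>. \<forall>n<length \<tau>. \<tau> ! 0 = x 1 \<and> x (2 * \<tau> ! n) = x (2 * x 1) \<and> embedding_step ((!) \<tau>) n}"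

lemma embedding_step_cong:
  assumes "\<And>i. i \<le> n \<Longrightarrow> g i = g' i"
  shows "embedding_step g n \<longleftrightarrow> embedding_step g' n"
  unfolding embedding_step_def using assms by (auto simp: le_diff_conv div_le_dividend)

lemma computable_embedding_tree:
  "computable 1 (\<lambda>x as. code_tree (embedding_tree x) (as ! 0))"
proof -
  let ?nth = "\<lambda>as i. list_hd ((list_tl ^^ i) (as ! 0))"
  have *: "computable 1 (\<lambda>x as. of_bool (\<forall>n<length (list_decode (as ! 0)).
     ?nth as 0 = x 1 \<and> x (2 * ?nth as n) = x (2 * x 1) \<and>
     (0 < n \<longrightarrow> \<not> ?nth as ((n - 1) div 2) = ?nth as n \<and> bin_prefix (?nth as ((n - 1) div 2)) (?nth as n)) \<and>
     (0 < n \<and> even n \<longrightarrow> \<not> bin_prefix (?nth as (n - 1)) (?nth as n) \<and>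
        \<not> bin_prefix (?nth as n) (?nth as (n - 1)))))"
    \<comment> \<open>The closure rules cover equality and negation but not strict inequality, so
      positivity is expressed as being nonzero.\<close>
    unfolding neq0_conv[symmetric] by (intro computable_intros) simp_all
  have "code_tree (embedding_tree x) m = of_bool (\<forall>n<length (list_decode m).
     ?nth [m] 0 = x 1 \<and> x (2 * ?nth [m] n) = x (2 * x 1) \<and> embedding_step (?nth [m]) n)" for x m
  proof -
    \<comment> \<open>Iterated tails give the right entries only inside the list; that suffices, as
      the step at \<open>n\<close> looks at no index above \<open>n\<close>.\<close>
    have "embedding_step ((!) (list_decode m)) n \<longleftrightarrow> embedding_step (?nth [m]) n"
      if "n < length (list_decode m)" for n
      using that by (intro embedding_step_cong) (simp add: list_decode_nth)
    moreover have "list_decode m ! 0 = ?nth [m] 0" if "n < length (list_decode m)" for n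
      using list_decode_nth[of 0 m] that by fastforce
    ultimately have "(\<forall>n<length (list_decode m). list_decode m ! 0 = x 1 \<and>
        x (2 * list_decode m ! n) = x (2 * x 1) \<and> embedding_step ((!) (list_decode m)) n) \<longleftrightarrow>
      (\<forall>n<length (list_decode m).
        ?nth [m] 0 = x 1 \<and> x (2 * ?nth [m] n) = x (2 * x 1) \<and> embedding_step (?nth [m]) n)"
      using list_decode_nth[of _ m] by (metis nth_Cons_0)
    then show ?thesis unfolding code_tree_def embedding_tree_def by simp
  qed
  then show ?thesis
    by (intro computable_cong[OF *]) (auto simp: length_Suc_conv embedding_step_def)
qed

lemma TT1_Ext_le_WF: "TT1_Ext k \<le>\<^sub>W WF_problem"
proof (rule weihrauch_le_complement[OF computable_embedding_tree])
  fix x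
  assume "is_instance (TT1_Ext k) x"
  then obtain f \<sigma> where f: "range f \<subseteq> {..<k}" and x: "x = code_coloring f \<oplus> code_nat (bin_encode \<sigma>)"
    unfolding is_instance_def TT1_Ext_def by blast
  have x1: "x 1 = bin_encode \<sigma>" and xf: "x (2 * m) = f (bin_decode m)" for m
    by (simp_all add: x join_def code_nat_def code_coloring_def bin_decode_def)
  \<comment> \<open>Repeating the condition on the root at every \<open>n\<close> puts all
    requirements into local form; the empty list satisfies them vacuously.\<close>
  let ?P = "\<lambda>g n. g 0 = x 1 \<and> x (2 * g n) = x (2 * x 1) \<and> embedding_step g n"
  have local: "?P g' n" if "\<And>i. i \<le> n \<Longrightarrow> g i = g' i" "?P g n" for g g' :: "nat \<Rightarrow> nat" and n
    using that embedding_step_cong[of n g g'] by auto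
  have "is_tree (embedding_tree x)"
    unfolding embedding_tree_def by (rule is_tree_local[where P = ?P]) (rule local)
  moreover have "has_infinite_path (embedding_tree x) \<longleftrightarrow> (\<exists>g. \<forall>n. ?P g n)"
    unfolding embedding_tree_def by (rule has_infinite_path_local[where P = ?P]) (rule local)
  then have "has_infinite_path (embedding_tree x) \<longleftrightarrow> (\<exists>H. H \<cong>\<^sub>p UNIV \<and> monochromatic f H \<and> \<sigma> \<in> H)"
    unfolding embedding_exists_iff x1 xf bin_decode_encode by blast
  ultimately show "\<exists>b. TT1_Ext k x = {code_nat (of_bool b)} \<and>
      WF_problem (\<lambda>n. code_tree (embedding_tree x) ([n] ! 0)) = {code_nat (of_bool (\<not> b))}"
    using f unfolding x TT1_Ext_code by (intro exI[of _ "has_infinite_path (embedding_tree x)"])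
      (auto simp: WF_problem_code_tree x)
qed

lemma WF_le_TT1_Ext:
  assumes "k \<ge> 2"
  shows "WF_problem \<le>\<^sub>W TT1_Ext k"
proof -
  \<comment> \<open>Even positions carry the colouring; odd ones are 0, since the empty string has
    code 0. Decoding the encoded blocks changes nothing, but matches the rules for
    \<open>blocks\<close> and for mapping over a coded list.\<close>
  define F :: "baire \<Rightarrow> nat list \<Rightarrow> nat" where
    "F x as = (if even (as ! 0) then if as ! 0 = 0 then 1 else
       x (list_encode (map (\<lambda>a. a div 2) (list_decode (list_encode (blocks (bin_decode (as ! 0 div 2)))))))
       else 0)" for x as
  have "computable 1 F"
    unfolding F_def by (intro computable_intros computable_map_list_decode) simp_all
  then show ?thesis
  proof (rule weihrauch_le_complement)
    fix x
    assume "is_instance WF_problem x"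
    then obtain T where T: "is_tree T" and x: "x = code_tree T"
      unfolding is_instance_def WF_problem_def by blast
    have root: "bin_decode n = [] \<longleftrightarrow> n = 0" for n
      by (metis bin_decode_0 bin_decode_eq_iff)
    have "(\<lambda>n. F x [n]) = code_coloring (tree_coloring T) \<oplus> code_nat (bin_encode [])"
      by (rule ext) (auto simp: F_def x join_def code_nat_def code_coloring_def code_tree_def
          tree_coloring_def root simp flip: bin_decode_def)
    moreover have "range (tree_coloring T) \<subseteq> {..<k}" using assms by (auto simp: tree_coloring_def)
    moreover have "(\<exists>H. H \<cong>\<^sub>p UNIV \<and> monochromatic (tree_coloring T) H \<and> [] \<in> H) \<longleftrightarrow> has_infinite_path T"
      using infinite_path_imp_embedding embedding_imp_infinite_path[OF T] by blast
    ultimately show "\<exists>b. WF_problem x = {code_nat (of_bool b)} \<and>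
        TT1_Ext k (\<lambda>n. F x [n]) = {code_nat (of_bool (\<not> b))}"
      using T by (intro exI[of _ "\<not> has_infinite_path T"])
        (simp add: TT1_Ext_code WF_problem_code_tree x del: bin_encode.simps)
  qed
qed

theorem theorem3p2:
  fixes k :: nat
  assumes "k \<ge> 2"
  shows "TT1_Ext k \<equiv>\<^sub>W WF_problem"
  unfolding weihrauch_equiv_def using TT1_Ext_le_WF WF_le_TT1_Ext[OF assms] by blast

end
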